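(* For every integer $n\geq 2$, the path $P_n$ on $n$ vertices satisfies $b_{dR}(P_n)=1$.
   Context: All graphs are finite, simple and undirected. For a graph $G=(V,E)$, a double Roman dominating function (DRDF) is a function $f:V\to\{0,1,2,3\}$ such that every vertex $v$ with $f(v)=0$ has at least two neighbors $u$ with $f(u)=2$ or at least one neighbor $w$ with $f(w)=3$, and every vertex $v$ with $f(v)=1$ has at least one neighbor $w$ with $f(w)\geq 2$. The weight of $f$ is $\sum_{u\in V}f(u)$, and the double Roman domination number $\gamma_{dR}(G)$ is the minimum weight of a DRDF on $G$. The double Roman bondage number $b_{dR}(G)$ of a graph $G$ with at least one edge is the minimum cardinality of an edge set $B\subseteq E(G)$ such that $\gamma_{dR}(G-B)>\gamma_{dR}(G)$, where $G-B$ is the spanning subgraph obtained by deleting the edges of $B$. *)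

theory Defs
  imports Main
begin

text \<open>
  A finite simple undirected graph is a pair of a finite vertex set and a set of
  two-element subsets of it.
\<close>

type_synonym 'a sgraph = "'a set \<times> 'a set set"

abbreviation verts :: "'a sgraph \<Rightarrow> 'a set" where
  "verts G \<equiv> fst G"

abbreviation edges :: "'a sgraph \<Rightarrow> 'a set set" where
  "edges G \<equiv> snd G"

definition simple_graph :: "'a sgraph \<Rightarrow> bool" where
  "simple_graph G \<longleftrightarrow>
     finite (verts G) \<and> (\<forall>e \<in> edges G. e \<subseteq> verts G \<and> card e = 2)"

definition nbrs :: "'a sgraph \<Rightarrow> 'a \<Rightarrow> 'a set" where
  "nbrs G v = {u \<in> verts G. {u, v} \<in> edges G}"

definition delete_edges :: "'a sgraph \<Rightarrow> 'a set set \<Rightarrow> 'a sgraph" where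
  "delete_edges G B = (verts G, edges G - B)"

text \<open>Values of \<open>f\<close> outside the vertex set are unconstrained and irrelevant.\<close>

definition drdf :: "'a sgraph \<Rightarrow> ('a \<Rightarrow> nat) \<Rightarrow> bool" where
  "drdf G f \<longleftrightarrow>
     (\<forall>v \<in> verts G. f v \<in> {0, 1, 2, 3}) \<and>
     (\<forall>v \<in> verts G. f v = 0 \<longrightarrow>
        card {u \<in> nbrs G v. f u = 2} \<ge> 2 \<or> (\<exists>w \<in> nbrs G v. f w = 3)) \<and>
     (\<forall>v \<in> verts G. f v = 1 \<longrightarrow> (\<exists>w \<in> nbrs G v. f w \<ge> 2))"

definition weight :: "'a sgraph \<Rightarrow> ('a \<Rightarrow> nat) \<Rightarrow> nat" where
  "weight G f = (\<Sum>u \<in> verts G. f u)"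

definition gamma_dR :: "'a sgraph \<Rightarrow> nat" where
  "gamma_dR G = (LEAST w. \<exists>f. drdf G f \<and> weight G f = w)"

text \<open>
  The minimum is taken over a set of naturals that is nonempty when \<open>G\<close> is a simple
  graph with at least one edge; otherwise the value is unspecified.
\<close>

definition b_dR :: "'a sgraph \<Rightarrow> nat" where
  "b_dR G =
     (LEAST k. \<exists>B. B \<subseteq> edges G \<and> card B = k \<and> gamma_dR (delete_edges G B) > gamma_dR G)"

definition path_graph :: "nat \<Rightarrow> nat sgraph" where
  "path_graph n = ({0..<n}, {{i, Suc i} | i. Suc i < n})"

lemma simple_graph_path_graph: "simple_graph (path_graph n)"
  by (auto simp: simple_graph_def path_graph_def)

lemma simple_graph_delete_edges: "simple_graph G \<Longrightarrow> simple_graph (delete_edges G B)"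
  by (auto simp: simple_graph_def delete_edges_def)

lemma edges_path_graph_nonempty: "n \<ge> 2 \<Longrightarrow> edges (path_graph n) \<noteq> {}"
  by (auto simp: path_graph_def intro: exI[of _ 0])

end

theory Submission
  imports Defs
begin

text \<open>
  Every double Roman dominating function on a path component with \<open>m\<close> vertices has weight at
  least \<open>m\<close>, and at least \<open>m + 1\<close> if 3 does not divide \<open>m\<close>; for the whole path this bound is
  attained. Deleting the first edge (if \<open>n mod 3 \<noteq> 1\<close>) or the second edge (if \<open>n mod 3 = 1\<close>)
  leaves two paths whose bounds add up to more than the bound for the path on \<open>n\<close> vertices.
  The lower bound comes from a scan along the path whose state consists of the last two
  values and the position modulo 3.
\<close>

text \<open>
  The minimal weight of a partial function on a prefix of length \<open>j\<close>, all of whose vertices but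
  possibly the last are already dominated, is at least \<open>j - 1\<close> plus \<open>prefix_excess (j mod 3) y x\<close>,
  where \<open>y, x\<close> are the last two values. The entries solve the min-plus recursion for this
  minimum, which is periodic from \<open>j = 1\<close> on.
\<close>

definition prefix_excess :: "nat \<Rightarrow> nat \<Rightarrow> nat \<Rightarrow> nat" where
  "prefix_excess r y x =
     (if x = 3 then (if r = 2 then 2 else 3)
      else if x = 2 then 2
      else if x = 1 then (if y < 2 \<and> r = 1 then 1 else 2)
      else if y = 3 then (if r = 0 then 1 else 2)
      else if y = 2 then 1
      else (if r = 1 then 0 else 1))"

text \<open>Meant for value sequences padded with 0 beyond both ends: a 0 helps to dominate nothing,
  so it can stand for a missing neighbour.\<close>

definition dominated_between :: "nat \<Rightarrow> nat \<Rightarrow> nat \<Rightarrow> bool" where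
  "dominated_between y x z \<longleftrightarrow>
     (x = 0 \<longrightarrow> y = 3 \<or> z = 3 \<or> y = 2 \<and> z = 2) \<and> (x = 1 \<longrightarrow> y \<ge> 2 \<or> z \<ge> 2)"

lemma le_3_cases: "(x::nat) \<le> 3 \<longleftrightarrow> x = 0 \<or> x = 1 \<or> x = 2 \<or> x = 3"
  by auto

lemma Suc_mod_3: "Suc j mod 3 = (if j mod 3 = 2 then 0 else Suc (j mod 3))"
  by presburger

text \<open>The position matters only through its residue modulo 3, so this is a finite check over
  three residues and the values of \<open>y\<close>, \<open>x\<close>, \<open>z\<close>. The
  \<open>+ 1\<close> pays for the prefix growing by one vertex.\<close>

lemma prefix_excess_step:
  assumes "y \<le> 3" "x \<le> 3" "z \<le> 3" "dominated_between y x z"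
  shows "prefix_excess (Suc j mod 3) x z + 1 \<le> prefix_excess (j mod 3) y x + z"
proof -
  have step: "prefix_excess (if r = 2 then 0 else Suc r) x z + 1 \<le> prefix_excess r y x + z"
    if "r = 0 \<or> r = 1 \<or> r = 2" for r
    using assms that unfolding le_3_cases
    by (elim disjE; hypsubst) (simp_all add: prefix_excess_def dominated_between_def)
  have "j mod 3 = 0 \<or> j mod 3 = 1 \<or> j mod 3 = 2" by presburger
  from step[OF this] show ?thesis unfolding Suc_mod_3 .
qed

lemma prefix_weight_ge:
  fixes g :: "nat \<Rightarrow> nat"
  assumes "g 0 = 0" and le3: "\<And>i. g i \<le> 3"
    and dom: "\<And>i. 1 \<le> i \<Longrightarrow> i \<le> m \<Longrightarrow> dominated_between (g (i - 1)) (g i) (g (Suc i))"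
    and "Suc j \<le> m"
  shows "j + prefix_excess (Suc j mod 3) (g j) (g (Suc j)) \<le> (\<Sum>i=1..Suc j. g i)"
  using \<open>Suc j \<le> m\<close>
proof (induction j)
  case 0
  \<comment> \<open>With the padding value 0 on the left, the excess in residue 1 is exactly
    \<open>g 1\<close>, so the scan starts with equality.\<close>
  then show ?case
    using le3[of 1] \<open>g 0 = 0\<close> unfolding le_3_cases by (auto simp: prefix_excess_def)
next
  case (Suc j)
  have "dominated_between (g j) (g (Suc j)) (g (Suc (Suc j)))"
    using dom[of "Suc j"] Suc.prems by simp
  from prefix_excess_step[OF le3 le3 le3 this, of "Suc j"] show ?case
    using Suc by simp
qed

lemma dominated_weight_ge:
  fixes g :: "nat \<Rightarrow> nat"
  assumes "g 0 = 0" and le3: "\<And>i. g i \<le> 3"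
    and dom: "\<And>i. 1 \<le> i \<Longrightarrow> i \<le> m \<Longrightarrow> dominated_between (g (i - 1)) (g i) (g (Suc i))"
    and end0: "g (Suc m) = 0"
  shows "m + (if 3 dvd m then 0 else 1) \<le> (\<Sum>i=1..m. g i)"
proof (cases m)
  case (Suc j)
  have "j + prefix_excess (m mod 3) (g j) (g m) \<le> (\<Sum>i=1..m. g i)"
    using prefix_weight_ge[of g m j] assms Suc by simp
  moreover have "dominated_between (g j) (g m) 0"
    using dom[of m] end0 Suc by simp
  \<comment> \<open>The last vertex gets no help from the right. Only the ending 3, 0 with 3
    dividing \<open>m\<close> has excess 1; all other admissible endings have at least 2. The scan
    contributes \<open>j\<close>, which is \<open>m - 1\<close>.\<close>
  then have "(if m mod 3 = 0 then 1 else 2) \<le> prefix_excess (m mod 3) (g j) (g m)"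
    using le3[of j] le3[of m] unfolding le_3_cases
    by (elim disjE) (simp_all add: prefix_excess_def dominated_between_def)
  ultimately show ?thesis
    using Suc by (auto simp: dvd_eq_mod_eq_0 split: if_splits)
qed simp

text \<open>Shifting the segment to positions 1 to \<open>m\<close> and padding with zeros reduces
  this to \<open>dominated_weight_ge\<close>. An inclusion of neighbourhoods suffices, since fewer
  neighbours only make domination harder.\<close>

lemma drdf_segment_weight_ge:
  fixes G :: "nat sgraph"
  assumes f: "drdf G f" and sub: "{a..<a + m} \<subseteq> verts G"
    and nb: "\<And>v. v \<in> {a..<a + m} \<Longrightarrow> nbrs G v \<subseteq> {u \<in> {a..<a + m}. u = Suc v \<or> v = Suc u}"
  shows "m + (if 3 dvd m then 0 else 1) \<le> (\<Sum>v=a..<a + m. f v)"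
proof -
  define g where "g i = (if 1 \<le> i \<and> i \<le> m then f (a + i - 1) else 0)" for i
  have g_left: "g (i - 1) = f u" if "1 \<le> i" "u \<in> {a..<a + m}" "a + i - 1 = Suc u" for i u
  proof -
    have "i - 1 = u - a + 1" "u - a + 1 \<le> m" "a + (u - a + 1) - 1 = u" using that by auto
    then show ?thesis by (simp add: g_def)
  qed
  have g_right: "g (Suc i) = f u" if "1 \<le> i" "u \<in> {a..<a + m}" "u = Suc (a + i - 1)" for i u
    using that by (auto simp: g_def)
  have fle: "f v \<le> 3" if "v \<in> {a..<a + m}" for v
    using f sub that unfolding drdf_def by force
  have "m + (if 3 dvd m then 0 else 1) \<le> (\<Sum>i=1..m. g i)"
  proof (rule dominated_weight_ge)
    show "g i \<le> 3" for i
    proof (cases "1 \<le> i \<and> i \<le> m")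
      case True
      then have "a + i - 1 \<in> {a..<a + m}" by auto
      then show ?thesis using fle True by (simp add: g_def)
    qed (auto simp: g_def)
  next
    fix i assume i: "1 \<le> i" "i \<le> m"
    define v where "v = a + i - 1"
    have v: "v \<in> {a..<a + m}" and gi: "g i = f v"
      using i by (auto simp: v_def g_def)
    then have vG: "v \<in> verts G" using sub by blast
    have nbr: "f u = g (i - 1) \<and> v = Suc u \<or> f u = g (Suc i) \<and> u = Suc v" if "u \<in> nbrs G v" for u
    proof -
      have "u \<in> {a..<a + m}" and "u = Suc v \<or> v = Suc u" using nb[OF v] that by auto
      then show ?thesis
        using g_left[OF i(1), of u] g_right[OF i(1), of u] unfolding v_def by metis
    qed
    have "g (i - 1) = 3 \<or> g (Suc i) = 3 \<or> g (i - 1) = 2 \<and> g (Suc i) = 2" if "f v = 0"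
    proof -
      have "card {u \<in> nbrs G v. f u = 2} \<ge> 2 \<or> (\<exists>w \<in> nbrs G v. f w = 3)"
        using f vG that by (simp add: drdf_def)
      then consider "card {u \<in> nbrs G v. f u = 2} \<ge> 2" | w where "w \<in> nbrs G v" "f w = 3"
        by blast
      then show ?thesis
      proof cases
        case 1
        then obtain T where "T \<subseteq> {u \<in> nbrs G v. f u = 2}" "card T = 2"
          by (rule obtain_subset_with_card_n)
        then obtain u w where "u \<in> nbrs G v" "w \<in> nbrs G v" "f u = 2" "f w = 2" "u \<noteq> w"
          unfolding card_2_iff by blast
        \<comment> \<open>Each side of \<open>v\<close> offers at most one neighbour, so two
          distinct ones lie on opposite sides.\<close>
        then show ?thesis using nbr[of u] nbr[of w] by (metis Suc_inject)
      next
        case 2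
        then show ?thesis using nbr[of w] by argo
      qed
    qed
    moreover have "g (i - 1) \<ge> 2 \<or> g (Suc i) \<ge> 2" if "f v = 1"
    proof -
      have "\<exists>w \<in> nbrs G v. f w \<ge> 2"
        using f vG that by (simp add: drdf_def)
      then obtain w where "w \<in> nbrs G v" "f w \<ge> 2" by blast
      then show ?thesis using nbr[of w] by auto
    qed
    ultimately show "dominated_between (g (i - 1)) (g i) (g (Suc i))"
      unfolding dominated_between_def gi by blast
  qed (auto simp: g_def)
  also have "(\<Sum>i=1..m. g i) = (\<Sum>v=a..<a + m. f v)"
    by (rule sum.reindex_bij_witness[of _ "\<lambda>v. Suc (v - a)" "\<lambda>i. a + i - 1"])
      (auto simp: g_def)
  finally show ?thesis .
qed

lemma gamma_dR_le_weight: "drdf G f \<Longrightarrow> gamma_dR G \<le> weight G f"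
  unfolding gamma_dR_def by (rule Least_le) blast

lemma gamma_dR_attained: "\<exists>f. drdf G f \<and> weight G f = gamma_dR G"
proof -
  \<comment> \<open>The constant 2 triggers no domination condition, so the minimum ranges over a
    nonempty set.\<close>
  have "drdf G (\<lambda>_. 2)" by (auto simp: drdf_def)
  then have "\<exists>w f. drdf G f \<and> weight G f = w" by blast
  then show ?thesis unfolding gamma_dR_def by (rule LeastI_ex)
qed

lemma nbrs_path_graph:
  "nbrs (path_graph n) v = {u. u < n \<and> v < n \<and> (u = Suc v \<or> v = Suc u)}"
  by (auto simp: nbrs_def path_graph_def doubleton_eq_iff)

lemma gamma_dR_path_graph_le:
  "gamma_dR (path_graph n) \<le> n + (if 3 dvd n then 0 else 1)"
proof -
  \<comment> \<open>Blocks 0, 3, 0 are repeated from the left. If \<open>n mod 3 = 1\<close>, the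
    single leftover vertex gets 2; if \<open>n mod 3 = 2\<close>, the last block is 0, 3.\<close>
  define f where "f i = (if i mod 3 = 1 then 3 else if n mod 3 = 1 \<and> Suc i = n then 2 else 0 :: nat)"
    for i
  have "\<exists>w\<in>nbrs (path_graph n) v. f w = 3" if "v < n" "f v = 0" for v
  proof -
    have "v mod 3 \<noteq> 1" using that by (auto simp: f_def)
    then consider "v mod 3 = 0" | "v mod 3 = 2" by linarith
    then show ?thesis
    proof cases
      case 1
      \<comment> \<open>A block start that is the last vertex of the path would carry the value 2,
        not 0.\<close>
      have "Suc v < n"
      proof (rule ccontr)
        assume "\<not> Suc v < n"
        then have "Suc v = n" using \<open>v < n\<close> by simp
        moreover from this have "n mod 3 = 1" using 1 by presburger
        ultimately show False using that 1 by (simp add: f_def)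
      qed
      moreover have "Suc v mod 3 = 1" using 1 by presburger
      ultimately show ?thesis using that
        by (intro bexI[of _ "Suc v"]) (auto simp: f_def nbrs_path_graph)
    next
      case 2
      then obtain u where "v = Suc u" by (cases v) auto
      moreover from this have "u mod 3 = 1" using 2 by presburger
      ultimately show ?thesis using that
        by (intro bexI[of _ u]) (auto simp: f_def nbrs_path_graph)
    qed
  qed
  then have "drdf (path_graph n) f"
    by (auto simp: drdf_def path_graph_def) (auto simp: f_def split: if_splits)
  moreover have "weight (path_graph n) f \<le> n + (if 3 dvd n then 0 else 1)"
  proof -
    have threes: "(\<Sum>i<k. if i mod 3 = 1 then 3 else 0 :: nat) = (if k mod 3 = 2 then k + 1 else k - k mod 3)" for k
    proof (induction k)
      case (Suc k)
      have "k mod 3 = 0 \<and> Suc k mod 3 = 1 \<or> k mod 3 = 1 \<and> Suc k mod 3 = 2 \<or> k mod 3 = 2 \<and> Suc k mod 3 = 0"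
        by presburger
      moreover have "k mod 3 \<le> k" by simp
      ultimately show ?case using Suc.IH by (elim disjE conjE) simp_all
    qed simp
    show ?thesis
    proof (cases "n mod 3 = 1")
      case False
      then have "weight (path_graph n) f = (\<Sum>i<n. if i mod 3 = 1 then 3 else 0)"
        unfolding weight_def path_graph_def
        by (auto simp: atLeast0LessThan f_def intro!: sum.cong)
      then show ?thesis using False unfolding threes by (auto simp: dvd_eq_mod_eq_0)
    next
      case True
      then obtain k where k: "n = Suc k" by (cases n) auto
      then have k0: "k mod 3 = 0" using True by presburger
      have "weight (path_graph n) f = (\<Sum>i<k. f i) + f k"
        unfolding weight_def path_graph_def by (simp add: atLeast0LessThan k)
      also have "(\<Sum>i<k. f i) = (\<Sum>i<k. if i mod 3 = 1 then 3 else 0)"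
        by (rule sum.cong) (auto simp: f_def k)
      also have "f k = 2" using True k k0 by (simp add: f_def)
      finally show ?thesis using True k k0 unfolding threes by (simp add: dvd_eq_mod_eq_0)
    qed
  qed
  ultimately show ?thesis using gamma_dR_le_weight le_trans by blast
qed

text \<open>No neighbours remain across the cut, so the segment bound applies to each piece of an
  optimal function, and the weights add.\<close>

lemma gamma_dR_cut_path_ge:
  assumes "Suc d < n"
  shows "(Suc d + (if 3 dvd Suc d then 0 else 1)) + ((n - Suc d) + (if 3 dvd (n - Suc d) then 0 else 1))
    \<le> gamma_dR (delete_edges (path_graph n) {{d, Suc d}})"
proof -
  let ?G = "delete_edges (path_graph n) {{d, Suc d}}"
  have verts: "verts ?G = {0..<n}" by (simp add: delete_edges_def path_graph_def)
  have nb: "nbrs ?G v = {u \<in> nbrs (path_graph n) v. {u, v} \<noteq> {d, Suc d}}" for v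
    by (auto simp: nbrs_def delete_edges_def)
  obtain f where f: "drdf ?G f" "weight ?G f = gamma_dR ?G"
    using gamma_dR_attained by blast
  have "Suc d + (if 3 dvd Suc d then 0 else 1) \<le> (\<Sum>v=0..<0 + Suc d. f v)"
    using assms
    by (intro drdf_segment_weight_ge[OF f(1)])
      (auto simp: verts nb nbrs_path_graph doubleton_eq_iff)
  moreover have "(n - Suc d) + (if 3 dvd (n - Suc d) then 0 else 1) \<le> (\<Sum>v=Suc d..<Suc d + (n - Suc d). f v)"
    using assms
    by (intro drdf_segment_weight_ge[OF f(1)])
      (auto simp: verts nb nbrs_path_graph doubleton_eq_iff)
  moreover have "weight ?G f = (\<Sum>v=0..<Suc d. f v) + (\<Sum>v=Suc d..<n. f v)"
    unfolding weight_def verts using assms by (intro sum.atLeastLessThan_concat[symmetric]) simp_all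
  ultimately show ?thesis using f(2) assms by simp
qed

theorem theorem2p1:
  fixes n :: nat
  assumes "n \<ge> 2"
  shows "b_dR (path_graph n) = 1"
  unfolding b_dR_def
proof (rule Least_equality)
  \<comment> \<open>This choice makes neither \<open>Suc d\<close> nor \<open>n - Suc d\<close>
    divisible by 3, so the pieces need weight at least \<open>n + 2\<close>. For
    \<open>n mod 3 = 1\<close>, cutting the first edge would leave a piece of length divisible by
    3.\<close>
  define d :: nat where "d = (if n mod 3 = 1 then 1 else 0)"
  have d: "Suc d < n"
    using assms by (cases "n = 2") (auto simp: d_def)
  have "n + (if 3 dvd n then 0 else 1)
    < (Suc d + (if 3 dvd Suc d then 0 else 1)) + ((n - Suc d) + (if 3 dvd (n - Suc d) then 0 else 1))"
  proof -
    consider "n mod 3 = 0" | "n mod 3 = 1" | "n mod 3 = 2" by linarith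
    then show ?thesis
    proof cases
      case 1
      then show ?thesis using d by (simp add: d_def dvd_eq_mod_eq_0)
    next
      case 2
      then have "\<not> 3 dvd (n - 2)" using assms by presburger
      then show ?thesis using 2 d by (simp add: d_def flip: numeral_2_eq_2)
    next
      case 3
      then have "\<not> 3 dvd (n - 1)" by presburger
      then show ?thesis using 3 d by (simp add: d_def)
    qed
  qed
  then have "gamma_dR (path_graph n) < gamma_dR (delete_edges (path_graph n) {{d, Suc d}})"
    using gamma_dR_path_graph_le[of n] gamma_dR_cut_path_ge[OF d] by linarith
  moreover have "{d, Suc d} \<in> edges (path_graph n)"
    using d by (auto simp: path_graph_def intro!: exI[of _ d])
  ultimately show "\<exists>B. B \<subseteq> edges (path_graph n) \<and> card B = 1 \<and>
      gamma_dR (path_graph n) < gamma_dR (delete_edges (path_graph n) B)"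
    by (intro exI[of _ "{{d, Suc d}}"]) simp
next
  fix k
  assume "\<exists>B. B \<subseteq> edges (path_graph n) \<and> card B = k \<and>
      gamma_dR (path_graph n) < gamma_dR (delete_edges (path_graph n) B)"
  then obtain B where B: "B \<subseteq> edges (path_graph n)" "card B = k"
    "gamma_dR (path_graph n) < gamma_dR (delete_edges (path_graph n) B)" by blast
  \<comment> \<open>An infinite set also has \<open>card\<close> 0, so finiteness is needed besides
    nonemptiness.\<close>
  have "edges (path_graph n) \<subseteq> Pow {0..<n}" by (auto simp: path_graph_def)
  then have "finite B" using B(1) by (meson finite_Pow_iff finite_atLeastLessThan finite_subset)
  moreover have "B \<noteq> {}" using B(3) by (auto simp: delete_edges_def)
  ultimately show "1 \<le> k" using B(2) card_gt_0_iff[of B] by simp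
qed

end
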